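(* Suppose $X$ is a strongly pseudoradial and weakly Hausdorff space. If $X$ is compact then $X$ is strongly pseudoradially compact.
   Context: A well-ordered space is a well-ordered set with the order topology. If $\alpha$ is a noncompact well-ordered space, $\alpha\cup\{\infty_\alpha\}$ denotes its one-point compactification, obtained by adding a maximal point $\infty_\alpha$ whose basic neighborhoods are $(a,\infty_\alpha]$, $a\in\alpha$. A map is a continuous function. A space $X$ is strongly pseudoradial if for each nonclosed $A\subset X$ there exist a noncompact well-ordered space $\alpha$ and a map $f:\alpha\cup\{\infty_\alpha\}\to X$ with $f(\alpha)\subset A$ and $f(\infty_\alpha)\notin A$. $X$ is weakly Hausdorff if every continuous map from a compact Hausdorff space into $X$ has closed image. Compact means every open cover has a finite subcover (no separation assumed). $X$ is strongly pseudoradially compact if for each noncompact well-ordered space $\alpha$ and each map $f:\alpha\to X$ there exists $\beta$ closed and cofinal in $\alpha$ such that $f|\beta$ is continuously extendable at $\infty_\alpha$, i.e. extends to a continuous function on the subspace $\beta\cup\{\infty_\alpha\}$ of $\alpha\cup\{\infty_\alpha\}$. *)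

theory Defs
  imports "HOL-Analysis.Analysis"
begin

section \<open>Well-ordered spaces\<close>

text \<open>A well-ordered set is a relation \<open>r\<close> with \<^term>\<open>Well_order r\<close>, with underlying set
  \<^term>\<open>Field r\<close>. The order topology is generated by the open rays; \<^term>\<open>Field r\<close> is added to
  the subbasis only for the sake of the one-point order, which has no nonempty open ray.\<close>

definition wo_topology :: "'b rel \<Rightarrow> 'b topology" where
  "wo_topology r =
     topology_generated_by (insert (Field r) (underS r ` Field r \<union> aboveS r ` Field r))"

text \<open>The compactification \<open>\<alpha> \<union> {\<infinity>}\<close> is the library's
  \<^term>\<open>Alexandroff_compactification (wo_topology r)\<close>, with points \<open>Some x\<close> for
  \<open>x \<in> \<alpha>\<close> and \<open>None\<close> for \<open>\<infinity>\<close>. That the sets \<open>(a, \<infinity>]\<close> are a neighbourhood basis at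
  \<open>\<infinity>\<close> is shown below, in \<open>openin_wo_compactification\<close>.\<close>

definition escaping_map :: "'b rel \<Rightarrow> 'a topology \<Rightarrow> 'a set \<Rightarrow> ('b option \<Rightarrow> 'a) \<Rightarrow> bool" where
  "escaping_map r X A f \<longleftrightarrow>
     Well_order r \<and> \<not> compact_space (wo_topology r) \<and>
     continuous_map (Alexandroff_compactification (wo_topology r)) X f \<and>
     f ` Some ` Field r \<subseteq> A \<and> f None \<notin> A"

text \<open>HOL cannot quantify over types inside a definition, so the well-ordered space is taken on
  a subset of \<open>'a \<times> nat\<close>. This is no restriction: a witness on a well-ordered set of any
  type yields one on a subset of \<open>'a \<times> nat\<close>, by \<open>escaping_map_universe\<close> below.\<close>

definition strongly_pseudoradial :: "'a topology \<Rightarrow> bool" where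
  "strongly_pseudoradial X \<longleftrightarrow>
     (\<forall>A. A \<subseteq> topspace X \<and> \<not> closedin X A \<longrightarrow>
        (\<exists>(r :: ('a \<times> nat) rel) f. escaping_map r X A f))"

text \<open>For the same reason the compact Hausdorff spaces range over those on subsets of
  \<open>'a set set\<close>; by \<open>weakly_HausdorffD\<close> below this implies the condition for
  compact Hausdorff spaces of every type.\<close>

definition weakly_Hausdorff :: "'a topology \<Rightarrow> bool" where
  "weakly_Hausdorff X \<longleftrightarrow>
     (\<forall>(K :: 'a set set topology) f.
        compact_space K \<and> Hausdorff_space K \<and> continuous_map K X f \<longrightarrow>
        closedin X (f ` topspace K))"

definition cofinal_in :: "'b rel \<Rightarrow> 'b set \<Rightarrow> bool" where
  "cofinal_in r B \<longleftrightarrow> B \<subseteq> Field r \<and> (\<forall>a\<in>Field r. \<exists>b\<in>B. (a, b) \<in> r)"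

text \<open>The type argument is the type on whose subsets the well-ordered spaces live. A theorem
  concluding \<open>strongly_pseudoradially_compact TYPE('b) X\<close> for a type variable \<open>'b\<close> covers
  well-ordered spaces of every type.\<close>

definition strongly_pseudoradially_compact :: "'b itself \<Rightarrow> 'a topology \<Rightarrow> bool" where
  "strongly_pseudoradially_compact (_ :: 'b itself) X \<longleftrightarrow>
     (\<forall>(r :: 'b rel) f.
        Well_order r \<and> \<not> compact_space (wo_topology r) \<and> continuous_map (wo_topology r) X f \<longrightarrow>
        (\<exists>B. closedin (wo_topology r) B \<and> cofinal_in r B \<and>
           (\<exists>g. continuous_map
                  (subtopology (Alexandroff_compactification (wo_topology r))
                     (insert None (Some ` B))) X g \<and>
                (\<forall>b\<in>B. g (Some b) = f b))))"


section \<open>Basic facts about well-ordered spaces\<close>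

lemma topspace_wo_topology [simp]: "topspace (wo_topology r) = Field r"
proof -
  have "underS r a \<subseteq> Field r" "aboveS r a \<subseteq> Field r" for a
    by (auto simp: underS_def aboveS_def Field_def)
  then show ?thesis
    unfolding wo_topology_def topology_generated_by_topspace by blast
qed

lemma Well_order_facts:
  assumes "Well_order r"
  shows Well_order_refl: "x \<in> Field r \<Longrightarrow> (x, x) \<in> r"
    and Well_order_trans: "(x, y) \<in> r \<Longrightarrow> (y, z) \<in> r \<Longrightarrow> (x, z) \<in> r"
    and Well_order_antisym: "(x, y) \<in> r \<Longrightarrow> (y, x) \<in> r \<Longrightarrow> x = y"
    and Well_order_total: "x \<in> Field r \<Longrightarrow> y \<in> Field r \<Longrightarrow> (x, y) \<in> r \<or> (y, x) \<in> r"
    and Well_order_least: "S \<subseteq> Field r \<Longrightarrow> S \<noteq> {} \<Longrightarrow> \<exists>a\<in>S. \<forall>b\<in>S. (a, b) \<in> r"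
proof -
  have lin: "Linear_order r" and wf: "wf (r - Id)"
    using assms by (auto simp: well_order_on_def)
  have part: "Refl r" "trans r" "antisym r" "Total r"
    using lin by (auto simp: order_on_defs)
  show refl: "x \<in> Field r \<Longrightarrow> (x, x) \<in> r" for x
    using part(1) by (auto simp: refl_on_def)
  show "(x, y) \<in> r \<Longrightarrow> (y, z) \<in> r \<Longrightarrow> (x, z) \<in> r" for x y z
    using part(2) by (meson transD)
  show "(x, y) \<in> r \<Longrightarrow> (y, x) \<in> r \<Longrightarrow> x = y" for x y
    using part(3) by (meson antisymD)
  show "x \<in> Field r \<Longrightarrow> y \<in> Field r \<Longrightarrow> (x, y) \<in> r \<or> (y, x) \<in> r" for x y
    using part(4) refl by (cases "x = y") (auto simp: total_on_def)
  show "S \<subseteq> Field r \<Longrightarrow> S \<noteq> {} \<Longrightarrow> \<exists>a\<in>S. \<forall>b\<in>S. (a, b) \<in> r" for S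
    using Linear_order_Well_order_iff[OF lin] assms by blast
qed

lemma aboveS_iff:
  assumes "Well_order r" "a \<in> Field r" "x \<in> Field r"
  shows "x \<in> aboveS r a \<longleftrightarrow> (x, a) \<notin> r"
proof -
  note w = Well_order_facts[OF assms(1)]
  show ?thesis
    unfolding aboveS_def using w(1)[OF assms(2)] w(3)[of x a] w(4)[OF assms(2,3)] by auto
qed

lemma openin_wo_topology:
  assumes wo: "Well_order r"
  shows "openin (wo_topology r) U \<longleftrightarrow>
    U \<subseteq> Field r \<and>
    (\<forall>x\<in>U. under r x \<subseteq> U \<or> (\<exists>a\<in>underS r x. under r x \<inter> aboveS r a \<subseteq> U))"
    (is "?L \<longleftrightarrow> ?R")
proof
  note wf = Well_order_facts[OF wo]
  let ?S = "insert (Field r) (underS r ` Field r \<union> aboveS r ` Field r)"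
  let ?P = "\<lambda>U. \<forall>x\<in>U. under r x \<subseteq> U \<or> (\<exists>a\<in>underS r x. under r x \<inter> aboveS r a \<subseteq> U)"
  show ?R if ?L
  proof -
    have "generate_topology_on ?S U"
      using that unfolding wo_topology_def by (rule openin_topology_generated_by)
    then have "?P U"
    proof (induction rule: generate_topology_on.induct)
      case (Int a b)
      show ?case
      proof
        fix x assume x: "x \<in> a \<inter> b"
        have "under r x \<subseteq> a \<or> (\<exists>c\<in>underS r x. under r x \<inter> aboveS r c \<subseteq> a)"
          "under r x \<subseteq> b \<or> (\<exists>c\<in>underS r x. under r x \<inter> aboveS r c \<subseteq> b)"
          using Int x by blast+
        moreover have "\<exists>e\<in>underS r x. under r x \<inter> aboveS r e \<subseteq> a \<inter> b"
          if "c \<in> underS r x" "d \<in> underS r x"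
            "under r x \<inter> aboveS r c \<subseteq> a" "under r x \<inter> aboveS r d \<subseteq> b" for c d
        proof (cases "(c, d) \<in> r")
          case True
          then have "aboveS r d \<subseteq> aboveS r c"
            unfolding aboveS_def using wf(2,3) by blast
          then show ?thesis using that by blast
        next
          case False
          then have "(d, c) \<in> r"
            using wf(4) that by (auto simp: underS_def Field_def)
          then have "aboveS r c \<subseteq> aboveS r d"
            unfolding aboveS_def using wf(2,3) by blast
          then show ?thesis using that by blast
        qed
        ultimately show "under r x \<subseteq> a \<inter> b \<or> (\<exists>e\<in>underS r x. under r x \<inter> aboveS r e \<subseteq> a \<inter> b)"
          by (smt (verit) Int_subset_iff le_infI1 order_trans)
      qed
    next
      case (UN K)
      then show ?case by (meson Sup_upper UnionE order_trans)
    next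
      case (Basis s)
      then consider "s = Field r" | a where "a \<in> Field r" "s = underS r a"
        | a where "a \<in> Field r" "s = aboveS r a" by blast
      then show ?case
      proof cases
        case 1 then show ?thesis by (auto simp: under_def Field_def)
      next
        case 2
        have "under r x \<subseteq> s" if "x \<in> s" for x
          using that 2 wf(2,3) unfolding under_def underS_def by blast
        then show ?thesis by blast
      next
        case 3
        have "a \<in> underS r x \<and> under r x \<inter> aboveS r a \<subseteq> s" if "x \<in> s" for x
          using that 3 unfolding aboveS_def underS_def by blast
        then show ?thesis by blast
      qed
    qed auto
    then show ?thesis
      using openin_subset[OF that] by simp
  qed
  show ?L if R: ?R
  proof -
    have basic: "openin (wo_topology r) T" if "T \<in> ?S" for T
      unfolding wo_topology_def using that by (rule topology_generated_by_Basis)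
    have under: "openin (wo_topology r) (under r x)" if "x \<in> Field r" for x
    proof (cases "aboveS r x = {}")
      case True
      then have "under r x = Field r"
        using aboveS_iff[OF wo that] under_Field[of r x] by (auto simp: under_def)
      then show ?thesis using basic by simp
    next
      case False
      then obtain s where s: "s \<in> aboveS r x" "\<And>b. b \<in> aboveS r x \<Longrightarrow> (s, b) \<in> r"
        using wf(5)[of "aboveS r x"] by (auto simp: aboveS_def Field_def)
      have sF: "s \<in> Field r" using s by (auto simp: aboveS_def Field_def)
      have "under r x = underS r s"
      proof
        show "under r x \<subseteq> underS r s"
          using s(1) wf(2,3) unfolding under_def underS_def aboveS_def by blast
        show "underS r s \<subseteq> under r x"
        proof
          fix y assume y: "y \<in> underS r s"
          then have "y \<in> Field r" by (auto simp: underS_def Field_def)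
          moreover have "y \<notin> aboveS r x"
            using y s(2)[of y] wf(3) by (auto simp: underS_def)
          ultimately show "y \<in> under r x"
            using aboveS_iff[OF wo that] by (auto simp: under_def)
        qed
      qed
      then show ?thesis using basic sF by simp
    qed
    show ?thesis
    proof (subst openin_subopen, intro ballI)
      fix x assume x: "x \<in> U"
      then have xF: "x \<in> Field r" using R by blast
      have xx: "x \<in> under r x" using wf(1)[OF xF] by (simp add: under_def)
      from R x consider "under r x \<subseteq> U"
        | a where "a \<in> underS r x" "under r x \<inter> aboveS r a \<subseteq> U" by blast
      then show "\<exists>T. openin (wo_topology r) T \<and> x \<in> T \<and> T \<subseteq> U"
      proof cases
        case 1 then show ?thesis using under[OF xF] xx by blast
      next
        case 2
        then have "a \<in> Field r" "x \<in> aboveS r a"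
          by (auto simp: underS_def aboveS_def Field_def)
        then have "openin (wo_topology r) (under r x \<inter> aboveS r a)"
          using under[OF xF] basic by (intro openin_Int) auto
        then show ?thesis using 2 xx \<open>x \<in> aboveS r a\<close> by blast
      qed
    qed
  qed
qed

lemma openin_underS_aboveS:
  assumes "a \<in> Field r"
  shows "openin (wo_topology r) (underS r a)" "openin (wo_topology r) (aboveS r a)"
  unfolding wo_topology_def by (rule topology_generated_by_Basis, use assms in blast)+

lemma closedin_under:
  assumes "Well_order r" "a \<in> Field r"
  shows "closedin (wo_topology r) (under r a)"
proof -
  have "aboveS r a \<subseteq> Field r" by (auto simp: aboveS_def Field_def)
  then have "Field r - under r a = aboveS r a"
    using aboveS_iff[OF assms] by (auto simp: under_def)
  then show ?thesis
    using openin_underS_aboveS[OF assms(2)] under_Field[of r a] by (simp add: closedin_def)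
qed

lemma compactin_under:
  assumes wo: "Well_order r"
  shows "compactin (wo_topology r) (under r a)"
proof -
  note wf = Well_order_facts[OF wo]
  have wfr: "wf (r - Id)" using wo by (simp add: well_order_on_def)
  show ?thesis
  proof (induction a rule: wf_induct_rule[OF wfr])
    case (1 x)
    show ?case
      unfolding compactin_def
    proof (intro conjI allI impI)
      show "under r x \<subseteq> topspace (wo_topology r)" by (simp add: under_Field)
      fix \<U> assume U: "Ball \<U> (openin (wo_topology r)) \<and> under r x \<subseteq> \<Union>\<U>"
      show "\<exists>\<F>. finite \<F> \<and> \<F> \<subseteq> \<U> \<and> under r x \<subseteq> \<Union>\<F>"
      proof (cases "x \<in> Field r")
        case False
        then have "under r x = {}" by (auto simp: under_def Field_def)
        then show ?thesis by (intro exI[of _ "{}"]) auto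
      next
        case True
        then have xx: "x \<in> under r x" using wf(1) by (simp add: under_def)
        then obtain V where V: "V \<in> \<U>" "x \<in> V" using U by blast
        then have "openin (wo_topology r) V" using U by blast
        then consider "under r x \<subseteq> V"
          | a where "a \<in> underS r x" "under r x \<inter> aboveS r a \<subseteq> V"
          using V unfolding openin_wo_topology[OF wo] by blast
        then show ?thesis
        proof cases
          case 1 then show ?thesis using V by (intro exI[of _ "{V}"]) auto
        next
          case 2
          have ax: "under r a \<subseteq> under r x"
            using 2(1) wf(2) by (auto simp: under_def underS_def)
          have "compactin (wo_topology r) (under r a)"
            using 2(1) by (intro 1) (auto simp: underS_def)
          then obtain \<F> where F: "finite \<F>" "\<F> \<subseteq> \<U>" "under r a \<subseteq> \<Union>\<F>"
            using U ax unfolding compactin_def by (meson order_trans)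
          have "under r x \<subseteq> under r a \<union> aboveS r a"
          proof
            fix y assume "y \<in> under r x"
            then have "(y, a) \<in> r \<or> (a, y) \<in> r" "a \<in> Field r"
              using 2(1) wf(4) by (auto simp: under_def underS_def Field_def)
            then show "y \<in> under r a \<union> aboveS r a"
              using wf(1) by (cases "y = a") (auto simp: under_def aboveS_def)
          qed
          then show ?thesis
            using F V 2 by (intro exI[of _ "insert V \<F>"]) auto
        qed
      qed
    qed
  qed
qed

lemma compactin_wo_bounded:
  assumes wo: "Well_order r" and K: "compactin (wo_topology r) K"
    and ne: "Field r \<noteq> {}" and nomax: "\<And>x. x \<in> Field r \<Longrightarrow> aboveS r x \<noteq> {}"
  shows "\<exists>a\<in>Field r. K \<subseteq> underS r a"
proof -
  note wf = Well_order_facts[OF wo]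
  have KF: "K \<subseteq> Field r" using compactin_subset_topspace[OF K] by simp
  have "K \<subseteq> \<Union>(underS r ` Field r)"
  proof
    fix x assume "x \<in> K"
    then have "aboveS r x \<noteq> {}" using nomax KF by blast
    then obtain y where "y \<noteq> x" "(x, y) \<in> r" by (auto simp: aboveS_def)
    then have "x \<in> underS r y" "y \<in> Field r" by (auto simp: underS_def Field_def)
    then show "x \<in> \<Union>(underS r ` Field r)" by blast
  qed
  moreover have "Ball (underS r ` Field r) (openin (wo_topology r))"
    using openin_underS_aboveS(1)[of _ r] by blast
  ultimately obtain \<F> where "finite \<F>" "\<F> \<subseteq> underS r ` Field r" "K \<subseteq> \<Union>\<F>"
    using K unfolding compactin_def by meson
  then obtain S where S: "finite S" "S \<subseteq> Field r" "K \<subseteq> \<Union>(underS r ` S)"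
    by (metis finite_subset_image)
  have "\<exists>a\<in>Field r. \<forall>s\<in>S. (s, a) \<in> r"
    using S(1,2)
  proof (induction S rule: finite_induct)
    case empty then show ?case using ne by blast
  next
    case (insert s S)
    then obtain a where a: "a \<in> Field r" "\<forall>s\<in>S. (s, a) \<in> r" by blast
    show ?case
    proof (cases "(s, a) \<in> r")
      case True then show ?thesis using a by blast
    next
      case False
      then have "(a, s) \<in> r" using wf(4) a insert.prems by blast
      then show ?thesis using a insert.prems wf(1,2) by blast
    qed
  qed
  then obtain a where a: "a \<in> Field r" "\<forall>s\<in>S. (s, a) \<in> r" by blast
  have "underS r s \<subseteq> underS r a" if "s \<in> S" for s
    using that a wf(2,3) unfolding underS_def by blast
  then show ?thesis using S(3) a(1) by blast
qed

lemma noncompact_wo_topology_iff: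
  assumes wo: "Well_order r"
  shows "\<not> compact_space (wo_topology r) \<longleftrightarrow>
    Field r \<noteq> {} \<and> (\<forall>x\<in>Field r. aboveS r x \<noteq> {})"
proof -
  note wf = Well_order_facts[OF wo]
  have "compact_space (wo_topology r)" if "Field r = {}"
    using that unfolding compact_space_def by simp
  moreover have "compact_space (wo_topology r)" if "x \<in> Field r" "aboveS r x = {}" for x
  proof -
    have "under r x = Field r"
      using aboveS_iff[OF wo that(1)] that(2) under_Field[of r x] by (auto simp: under_def)
    then show ?thesis
      using compactin_under[OF wo, of x] by (simp add: compact_space_def)
  qed
  moreover have False
    if "compact_space (wo_topology r)" "Field r \<noteq> {}" "\<forall>x\<in>Field r. aboveS r x \<noteq> {}"
    using compactin_wo_bounded[OF wo, of "Field r"] that underS_Field2[of _ r]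
    by (auto simp: compact_space_def)
  ultimately show ?thesis by blast
qed

lemma openin_wo_compactification:
  assumes wo: "Well_order r" and nc: "\<not> compact_space (wo_topology r)"
  shows "openin (Alexandroff_compactification (wo_topology r)) V \<longleftrightarrow>
    openin (wo_topology r) (Some -` V) \<and>
    (None \<in> V \<longrightarrow> (\<exists>a\<in>Field r. Some ` aboveS r a \<subseteq> V))"
proof -
  note wf = Well_order_facts[OF wo]
  have ne: "Field r \<noteq> {}" and nomax: "\<And>x. x \<in> Field r \<Longrightarrow> aboveS r x \<noteq> {}"
    using nc noncompact_wo_topology_iff[OF wo] by auto
  let ?X = "wo_topology r"
  show ?thesis
  proof (cases "None \<in> V")
    case False
    then have V: "V = Some ` (Some -` V)"
      by (auto simp: image_iff) (metis option.exhaust)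
    have "openin (Alexandroff_compactification ?X) (Some ` (Some -` V)) \<longleftrightarrow> openin ?X (Some -` V)"
      by (rule openin_Alexandroff_compactification_image_Some)
    then show ?thesis using False V by auto
  next
    case True
    show ?thesis
    proof
      assume V: "openin (Alexandroff_compactification ?X) V"
      then obtain C where C: "compactin ?X C" "closedin ?X C" "V = insert None (Some ` (topspace ?X - C))"
        using True unfolding openin_Alexandroff_compactification by blast
      have "Some -` V = topspace ?X - C" using C(3) by auto
      then have 1: "openin ?X (Some -` V)" using C(2) by (simp add: closedin_def)
      obtain a where a: "a \<in> Field r" "C \<subseteq> underS r a"
        using compactin_wo_bounded[OF wo C(1) ne nomax] by blast
      have "aboveS r a \<subseteq> Field r - C"
        using a wf(3) by (auto simp: aboveS_def underS_def Field_def)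
      then show "openin ?X (Some -` V) \<and> (None \<in> V \<longrightarrow> (\<exists>a\<in>Field r. Some ` aboveS r a \<subseteq> V))"
        using 1 a(1) C(3) by auto
    next
      assume R: "openin ?X (Some -` V) \<and> (None \<in> V \<longrightarrow> (\<exists>a\<in>Field r. Some ` aboveS r a \<subseteq> V))"
      then obtain a where a: "a \<in> Field r" "Some ` aboveS r a \<subseteq> V" using True by blast
      define C where "C = Field r - Some -` V"
      have cl: "closedin ?X C"
        using R unfolding C_def by (metis closedin_diff closedin_topspace topspace_wo_topology)
      have "C \<subseteq> under r a"
      proof
        fix x assume "x \<in> C"
        then have "x \<in> Field r" "x \<notin> aboveS r a" using a by (auto simp: C_def)
        then show "x \<in> under r a"
          using aboveS_iff[OF wo a(1)] by (auto simp: under_def)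
      qed
      then have "compactin ?X C"
        using closed_compactin[OF compactin_under[OF wo]] cl by blast
      moreover have "V = insert None (Some ` (topspace ?X - C))"
      proof -
        have "Some -` V \<subseteq> Field r" using R openin_subset by fastforce
        then have "topspace ?X - C = Some -` V" by (auto simp: C_def)
        moreover have "z \<in> V \<longleftrightarrow> z \<in> insert None (Some ` (Some -` V))" for z
          using True by (cases z) auto
        then have "V = insert None (Some ` (Some -` V))" by blast
        ultimately show ?thesis by simp
      qed
      ultimately show "openin (Alexandroff_compactification ?X) V"
        using cl unfolding openin_Alexandroff_compactification by blast
    qed
  qed
qed


section \<open>Independence of the chosen types\<close>

lemma continuous_map_wo_compactification:
  fixes r :: "'b rel" and r' :: "'c rel"
  assumes wo: "Well_order r" and nc: "\<not> compact_space (wo_topology r)"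
    and wo': "Well_order r'" and nc': "\<not> compact_space (wo_topology r')"
    and kF: "k ` Field r' \<subseteq> Field r"
    and mono: "\<And>x y. x \<in> Field r' \<Longrightarrow> y \<in> Field r' \<Longrightarrow> (x, y) \<in> r' \<longleftrightarrow> (k x, k y) \<in> r"
    and cl: "closedin (wo_topology r) (k ` Field r')"
    and cof: "cofinal_in r (k ` Field r')"
  shows "continuous_map (Alexandroff_compactification (wo_topology r'))
    (Alexandroff_compactification (wo_topology r)) (map_option k)"
proof -
  note w = Well_order_facts[OF wo] and w' = Well_order_facts[OF wo']
  have strict: "k y \<noteq> k x" if "y \<in> underS r' x" for x y
  proof
    assume eq: "k y = k x"
    have F: "x \<in> Field r'" "y \<in> Field r'" using that by (auto simp: underS_def Field_def)
    have "(k x, k y) \<in> r" using w(1)[of "k x"] kF F eq by auto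
    then have "(x, y) \<in> r'" using mono F by blast
    then show False using that w'(3)[of x y] by (auto simp: underS_def)
  qed
  have op: "openin (wo_topology r') (Field r' \<inter> k -` U)" if U: "openin (wo_topology r) U" for U
    unfolding openin_wo_topology[OF wo']
  proof (intro conjI ballI)
    fix x assume x: "x \<in> Field r' \<inter> k -` U"
    let ?V = "Field r' \<inter> k -` U"
    have "under r (k x) \<subseteq> U \<or> (\<exists>a\<in>underS r (k x). under r (k x) \<inter> aboveS r a \<subseteq> U)"
      using U x unfolding openin_wo_topology[OF wo] by blast
    then consider "under r (k x) \<subseteq> U" | "underS r' x = {}"
      | a y where "a \<in> underS r (k x)" "under r (k x) \<inter> aboveS r a \<subseteq> U" "y \<in> underS r' x" "(a, k y) \<in> r"
      | a where "a \<in> underS r (k x)" "\<forall>y\<in>underS r' x. (a, k y) \<notin> r" "underS r' x \<noteq> {}"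
      by blast
    then show "under r' x \<subseteq> ?V \<or> (\<exists>a\<in>underS r' x. under r' x \<inter> aboveS r' a \<subseteq> ?V)"
    proof cases
      case 1
      have "under r' x \<subseteq> ?V"
      proof
        fix y assume y: "y \<in> under r' x"
        then have "y \<in> Field r'" using under_Field[of r' x] by blast
        then have "k y \<in> under r (k x)" using mono[of y x] x y by (simp add: under_def)
        then show "y \<in> ?V" using 1 \<open>y \<in> Field r'\<close> by auto
      qed
      then show ?thesis ..
    next
      case 2
      then have "under r' x \<subseteq> ?V"
        using x by (auto simp: under_def underS_def)
      then show ?thesis ..
    next
      case (3 a y)
      have "under r' x \<inter> aboveS r' y \<subseteq> ?V"
      proof
        fix z assume z: "z \<in> under r' x \<inter> aboveS r' y"
        then have F: "z \<in> Field r'" "y \<in> Field r'" "x \<in> Field r'" "y \<in> underS r' z"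
          by (auto simp: under_def aboveS_def underS_def Field_def)
        have "(k z, k x) \<in> r" "(k y, k z) \<in> r" "k y \<noteq> k z"
          using z F mono strict[OF F(4)] by (auto simp: under_def aboveS_def)
        then have "k z \<in> under r (k x) \<inter> aboveS r a"
          using 3(4) w(2,3) unfolding under_def aboveS_def by blast
        then show "z \<in> ?V" using 3(2) F by auto
      qed
      then show ?thesis using 3(3) by blast
    next
      case (4 a)
      have sub: "underS r' x \<subseteq> Field r'" by (auto simp: underS_def Field_def)
      have xF: "x \<in> Field r'" using x by blast
      have aF: "a \<in> Field r" using 4(1) by (auto simp: underS_def Field_def)
      define B where "B = {s \<in> Field r. \<forall>y\<in>underS r' x. (k y, s) \<in> r}"
      have "a \<in> B"
        using 4(2) w(4) aF kF sub unfolding B_def by blast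
      then obtain s where s: "s \<in> B" "\<And>b. b \<in> B \<Longrightarrow> (s, b) \<in> r"
        using w(5)[of B] unfolding B_def by blast
      have sF: "s \<in> Field r" using s(1) by (simp add: B_def)
      have sx: "(s, k x) \<in> r" "s \<noteq> k x"
        using s(2)[OF \<open>a \<in> B\<close>] 4(1) w(2,3) unfolding underS_def by blast+
      show ?thesis
      proof (cases "s \<in> k ` underS r' x")
        case True
        then obtain y where y: "y \<in> underS r' x" "s = k y" by blast
        have "under r' x \<inter> aboveS r' y \<subseteq> {x}"
        proof
          fix z assume z: "z \<in> under r' x \<inter> aboveS r' y"
          show "z \<in> {x}"
          proof (rule ccontr)
            assume "z \<notin> {x}"
            then have zx: "z \<in> underS r' x" using z by (auto simp: under_def underS_def)
            then have "(k z, k y) \<in> r" using s(1) y(2) by (auto simp: B_def)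
            then have "(z, y) \<in> r'" using mono zx y(1) sub by blast
            then show False using z w'(3) by (auto simp: aboveS_def)
          qed
        qed
        then show ?thesis using y(1) x by blast
      next
        case False
        have "s \<notin> k ` Field r'"
        proof
          assume "s \<in> k ` Field r'"
          then obtain z where z: "z \<in> Field r'" "s = k z" by blast
          then have "(z, x) \<in> r'" "z \<noteq> x" using sx mono xF by auto
          then show False using False z by (auto simp: underS_def)
        qed
        moreover have "openin (wo_topology r) (Field r - k ` Field r')"
          using cl by (simp add: closedin_def)
        ultimately consider "under r s \<subseteq> Field r - k ` Field r'"
          | b where "b \<in> underS r s" "under r s \<inter> aboveS r b \<subseteq> Field r - k ` Field r'"
          using sF unfolding openin_wo_topology[OF wo] by blast
        then have False
        proof cases
          case 1
          obtain y where "y \<in> underS r' x" using 4(3) by blast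
          then have "k y \<in> under r s" "k y \<in> k ` Field r'"
            using s(1) sub by (auto simp: B_def under_def)
          then show ?thesis using 1 by blast
        next
          case (2 b)
          have "b \<notin> B" using 2(1) s(2) w(3) by (auto simp: underS_def)
          moreover have bF: "b \<in> Field r" using 2(1) by (auto simp: underS_def Field_def)
          ultimately obtain y where y: "y \<in> underS r' x" "(k y, b) \<notin> r" by (auto simp: B_def)
          have "k y \<in> Field r" using y(1) sub kF by blast
          then have "k y \<in> aboveS r b"
            using y(2) aboveS_iff[OF wo bF] by blast
          moreover have "k y \<in> under r s" "k y \<in> k ` Field r'"
            using s(1) y(1) sub by (auto simp: B_def under_def)
          ultimately show ?thesis using 2(2) by blast
        qed
        then show ?thesis ..
      qed
    qed
  qed auto
  show ?thesis
    unfolding continuous_map_def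
  proof (intro conjI allI impI)
    show "map_option k \<in> topspace (Alexandroff_compactification (wo_topology r')) \<rightarrow>
        topspace (Alexandroff_compactification (wo_topology r))"
      using kF by auto
    fix U assume U: "openin (Alexandroff_compactification (wo_topology r)) U"
    let ?W = "{x \<in> topspace (Alexandroff_compactification (wo_topology r')). map_option k x \<in> U}"
    have "Some -` ?W = Field r' \<inter> k -` (Some -` U)" by auto
    then have 1: "openin (wo_topology r') (Some -` ?W)"
      using op U unfolding openin_wo_compactification[OF wo nc] by simp
    have "\<exists>b\<in>Field r'. Some ` aboveS r' b \<subseteq> ?W" if "None \<in> ?W"
    proof -
      have "None \<in> U" using that by auto
      then obtain a where a: "a \<in> Field r" "Some ` aboveS r a \<subseteq> U"
        using U unfolding openin_wo_compactification[OF wo nc] by blast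
      then obtain b where b: "b \<in> Field r'" "(a, k b) \<in> r"
        using cof unfolding cofinal_in_def by blast
      have "Some ` aboveS r' b \<subseteq> ?W"
      proof (rule image_subsetI)
        fix z assume z: "z \<in> aboveS r' b"
        then have F: "z \<in> Field r'" "b \<in> underS r' z"
          by (auto simp: aboveS_def underS_def Field_def)
        have "(k b, k z) \<in> r" "k b \<noteq> k z"
          using z F b mono strict[OF F(2)] by (auto simp: aboveS_def)
        then have "k z \<in> aboveS r a"
          using b(2) w(2,3) unfolding aboveS_def by blast
        then show "Some z \<in> ?W" using a(2) F by auto
      qed
      then show ?thesis using b(1) by blast
    qed
    then show "openin (Alexandroff_compactification (wo_topology r')) ?W"
      using 1 unfolding openin_wo_compactification[OF wo' nc'] by blast
  qed
qed

lemma Well_order_transport: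
  assumes wo: "Well_order r" and C: "C \<subseteq> Field r" and inj: "inj_on h C"
  defines "r' \<equiv> {(h x, h y) |x y. x \<in> C \<and> y \<in> C \<and> (x, y) \<in> r}"
  shows "Well_order r'" "Field r' = h ` C"
    "\<And>x y. x \<in> C \<Longrightarrow> y \<in> C \<Longrightarrow> (h x, h y) \<in> r' \<longleftrightarrow> (x, y) \<in> r"
proof -
  note w = Well_order_facts[OF wo]
  show iff: "(h x, h y) \<in> r' \<longleftrightarrow> (x, y) \<in> r" if "x \<in> C" "y \<in> C" for x y
    using that inj unfolding r'_def inj_on_def by blast
  show F: "Field r' = h ` C"
  proof
    show "Field r' \<subseteq> h ` C" by (auto simp: r'_def Field_def)
    show "h ` C \<subseteq> Field r'"
    proof (rule image_subsetI)
      fix x assume "x \<in> C"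
      then have "(h x, h x) \<in> r'" using iff w(1) C by blast
      then show "h x \<in> Field r'" by (rule FieldI1)
    qed
  qed
  have "refl_on (Field r') r'"
    unfolding refl_on_def using iff w(1) C by (auto simp: F)
  moreover have "trans r'"
  proof (rule transI)
    fix a b c assume "(a, b) \<in> r'" "(b, c) \<in> r'"
    moreover from this obtain x y z where "a = h x" "b = h y" "c = h z" "x \<in> C" "y \<in> C" "z \<in> C"
      unfolding r'_def by blast
    ultimately show "(a, c) \<in> r'" using iff w(2) by blast
  qed
  moreover have "antisym r'"
  proof (rule antisymI)
    fix a b assume "(a, b) \<in> r'" "(b, a) \<in> r'"
    moreover from this obtain x y where "a = h x" "b = h y" "x \<in> C" "y \<in> C"
      unfolding r'_def by blast
    ultimately show "a = b" using iff w(3) by blast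
  qed
  moreover have "total_on (Field r') r'"
    unfolding total_on_def F using iff w(4) C by blast
  moreover have "r' \<subseteq> Field r' \<times> Field r'" by (auto simp: Field_def)
  ultimately have lin: "Linear_order r'"
    by (simp add: order_on_defs)
  show "Well_order r'"
    unfolding Linear_order_Well_order_iff[OF lin]
  proof (intro allI impI)
    fix A assume A: "A \<subseteq> Field r'" "A \<noteq> {}"
    let ?A = "{x \<in> C. h x \<in> A}"
    obtain c where "c \<in> A" using A(2) by blast
    moreover from this obtain x where "x \<in> C" "c = h x" using A(1) unfolding F by blast
    ultimately have "?A \<noteq> {}" by blast
    then obtain a where "a \<in> ?A" "\<forall>b\<in>?A. (a, b) \<in> r"
      using w(5)[of ?A] C by blast
    then have "\<forall>c\<in>A. (h a, c) \<in> r'" using A(1) iff unfolding F by blast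
    then show "\<exists>a\<in>A. \<forall>a'\<in>A. (a, a') \<in> r'" using \<open>a \<in> ?A\<close> by blast
  qed
qed

theorem escaping_map_universe:
  fixes r :: "'b rel" and X :: "'a topology"
  assumes "escaping_map r X A f"
  shows "\<exists>(r' :: ('a \<times> nat) rel) f'. escaping_map r' X A f'"
proof -
  let ?X = "wo_topology r"
  have wo: "Well_order r" and nc: "\<not> compact_space ?X"
    and cont: "continuous_map (Alexandroff_compactification ?X) X f"
    and fA: "f ` Some ` Field r \<subseteq> A" and fN: "f None \<notin> A"
    using assms by (auto simp: escaping_map_def)
  note w = Well_order_facts[OF wo]
  have ne: "Field r \<noteq> {}" and nomax: "\<And>x. x \<in> Field r \<Longrightarrow> aboveS r x \<noteq> {}"
    using nc noncompact_wo_topology_iff[OF wo] by auto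
  have ftop: "f None \<in> topspace X" "\<And>x. x \<in> Field r \<Longrightarrow> f (Some x) \<in> topspace X"
    using cont by (auto simp: continuous_map_def Pi_iff)
  show ?thesis
  proof (cases "\<exists>x\<in>f ` Some ` Field r. \<forall>a\<in>Field r. \<exists>b\<in>aboveS r a. f (Some b) = x")
    case True
    then obtain x where x: "x \<in> f ` Some ` Field r"
      "\<And>a. a \<in> Field r \<Longrightarrow> \<exists>b\<in>aboveS r a. f (Some b) = x" by blast
    have near: "x \<in> U" if U: "openin X U" "f None \<in> U" for U
    proof -
      have "openin (Alexandroff_compactification ?X)
          {y \<in> topspace (Alexandroff_compactification ?X). f y \<in> U}" (is "openin _ ?W")
        using cont U by (simp add: continuous_map_def)
      moreover have "None \<in> ?W" using U by simp
      ultimately obtain a where "a \<in> Field r" "Some ` aboveS r a \<subseteq> ?W"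
        unfolding openin_wo_compactification[OF wo nc] by blast
      then show ?thesis using x(2) by blast
    qed
    define h :: "nat \<Rightarrow> 'a \<times> nat" where "h n = (undefined, n)" for n
    define s where "s = {(m::nat, n). m \<le> n}"
    have Fs: "Field s = UNIV" by (auto simp: s_def Field_def)
    have lin: "Linear_order s"
      unfolding order_on_defs Fs
      by (auto simp: s_def refl_on_def trans_def antisym_def total_on_def)
    have wos: "Well_order s"
      unfolding Linear_order_Well_order_iff[OF lin]
    proof (intro allI impI)
      fix S :: "nat set" assume "S \<noteq> {}"
      then have "(LEAST n. n \<in> S) \<in> S" "\<forall>m\<in>S. (LEAST n. n \<in> S) \<le> m"
        by (auto intro: LeastI Least_le)
      then show "\<exists>a\<in>S. \<forall>a'\<in>S. (a, a') \<in> s" by (auto simp: s_def)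
    qed
    define r' where "r' = {(h x, h y) |x y. x \<in> UNIV \<and> y \<in> UNIV \<and> (x, y) \<in> s}"
    have inj: "inj_on h UNIV" by (auto simp: h_def inj_on_def)
    have wo': "Well_order r'" and F': "Field r' = range h"
      and iff: "\<And>m n. (h m, h n) \<in> r' \<longleftrightarrow> m \<le> n"
      using Well_order_transport[OF wos, of UNIV h] inj Fs unfolding r'_def by (auto simp: s_def)
    have "aboveS r' (h n) \<noteq> {}" for n
    proof -
      have "h (Suc n) \<in> aboveS r' (h n)" using iff by (simp add: aboveS_def h_def)
      then show ?thesis by blast
    qed
    then have nc': "\<not> compact_space (wo_topology r')"
      unfolding noncompact_wo_topology_iff[OF wo'] F' by auto
    define f' :: "('a \<times> nat) option \<Rightarrow> 'a"
      where "f' = (\<lambda>z. case z of None \<Rightarrow> f None | Some _ \<Rightarrow> x)"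
    have xA: "x \<in> A" and xX: "x \<in> topspace X" using x(1) fA ftop by auto
    have "continuous_map (Alexandroff_compactification (wo_topology r')) X f'"
      unfolding continuous_map_def
    proof (intro conjI allI impI)
      show "f' \<in> topspace (Alexandroff_compactification (wo_topology r')) \<rightarrow> topspace X"
        using xX ftop by (auto simp: f'_def)
      fix U assume U: "openin X U"
      let ?W = "{z \<in> topspace (Alexandroff_compactification (wo_topology r')). f' z \<in> U}"
      have "Some -` ?W = (if x \<in> U then topspace (wo_topology r') else {})"
        by (auto simp: f'_def)
      then have "openin (wo_topology r') (Some -` ?W)" by (metis openin_empty openin_topspace)
      moreover have "Some ` aboveS r' (h 0) \<subseteq> ?W" if "None \<in> ?W"
        using that near[OF U] by (auto simp: f'_def aboveS_def Field_def)
      ultimately show "openin (Alexandroff_compactification (wo_topology r')) ?W"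
        unfolding openin_wo_compactification[OF wo' nc'] using F' by blast
    qed
    then have "escaping_map r' X A f'"
      unfolding escaping_map_def using wo' nc' xA fN by (auto simp: f'_def)
    then show ?thesis by blast
  next
    case False
    define Y where "Y = f ` Some ` Field r"
    have "\<forall>y\<in>Y. \<exists>a\<in>Field r. \<forall>b\<in>Field r. f (Some b) = y \<longrightarrow> (b, a) \<in> r"
    proof
      fix y assume "y \<in> Y"
      then obtain a where a: "a \<in> Field r" "\<forall>b\<in>aboveS r a. f (Some b) \<noteq> y"
        using False unfolding Y_def by blast
      have "(b, a) \<in> r" if "b \<in> Field r" "f (Some b) = y" for b
      proof -
        have "b \<notin> aboveS r a" using a that by blast
        then show ?thesis using aboveS_iff[OF wo a(1) that(1)] by blast
      qed
      then show "\<exists>a\<in>Field r. \<forall>b\<in>Field r. f (Some b) = y \<longrightarrow> (b, a) \<in> r" using a by blast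
    qed
    then obtain u where u: "\<And>y. y \<in> Y \<Longrightarrow> u y \<in> Field r"
      "\<And>y b. y \<in> Y \<Longrightarrow> b \<in> Field r \<Longrightarrow> f (Some b) = y \<Longrightarrow> (b, u y) \<in> r" by metis
    define D where "D = u ` Y"
    have DF: "D \<subseteq> Field r" using u(1) by (auto simp: D_def)
    have Dcof: "\<exists>d\<in>D. (a, d) \<in> r" if "a \<in> Field r" for a
      using u(2)[of "f (Some a)" a] that by (auto simp: D_def Y_def)
    have DcofS: "\<exists>d\<in>D. d \<in> aboveS r a" if a: "a \<in> Field r" for a
    proof -
      obtain b where b: "b \<in> aboveS r a" using nomax[OF a] by blast
      then have "b \<in> Field r" by (auto simp: aboveS_def Field_def)
      then obtain d where "d \<in> D" "(b, d) \<in> r" using Dcof by blast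
      then have "d \<in> aboveS r a" using b w(2,3) unfolding aboveS_def by blast
      then show ?thesis using \<open>d \<in> D\<close> by blast
    qed
    define C where "C = ?X closure_of D"
    have CF: "C \<subseteq> Field r" unfolding C_def using closure_of_subset_topspace[of ?X D] by simp
    have DC: "D \<subseteq> C" unfolding C_def using DF by (simp add: closure_of_subset)
    have clC: "closedin ?X C" by (simp add: C_def)
    have "\<forall>c\<in>Field r. \<exists>d\<in>D. d \<in> aboveS r c \<and> (\<forall>e\<in>D. e \<in> aboveS r c \<longrightarrow> (d, e) \<in> r)"
    proof
      fix c assume "c \<in> Field r"
      then have "D \<inter> aboveS r c \<noteq> {}" using DcofS by blast
      then show "\<exists>d\<in>D. d \<in> aboveS r c \<and> (\<forall>e\<in>D. e \<in> aboveS r c \<longrightarrow> (d, e) \<in> r)"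
        using w(5)[of "D \<inter> aboveS r c"] DF by blast
    qed
    then obtain nx where nx: "\<And>c. c \<in> Field r \<Longrightarrow> nx c \<in> D"
      "\<And>c. c \<in> Field r \<Longrightarrow> nx c \<in> aboveS r c"
      "\<And>c e. c \<in> Field r \<Longrightarrow> e \<in> D \<Longrightarrow> e \<in> aboveS r c \<Longrightarrow> (nx c, e) \<in> r" by metis
    have nx_less: "nx c \<noteq> nx c'"
      if c: "c \<in> C" "c' \<in> C" "c' \<notin> D" "(c, c') \<in> r" "c \<noteq> c'" for c c'
    proof
      assume eq: "nx c = nx c'"
      have F: "c \<in> Field r" "c' \<in> Field r" using c CF by auto
      have "openin ?X (aboveS r c \<inter> underS r (nx c'))"
        using openin_underS_aboveS[of _ r] F nx(1) DF by (intro openin_Int) auto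
      moreover have "c' \<in> aboveS r c \<inter> underS r (nx c')"
        using c nx(2)[OF F(2)] by (auto simp: aboveS_def underS_def)
      ultimately obtain d where d: "d \<in> D" "d \<in> aboveS r c" "d \<in> underS r (nx c')"
        using c(2) unfolding C_def in_closure_of by blast
      have "(nx c, d) \<in> r" using nx(3) F d by blast
      then show False using d(3) eq w(3) by (auto simp: underS_def)
    qed
    define e where "e = inv_into Y u"
    have einj: "inj_on e D" unfolding e_def D_def by (rule inj_on_inv_into) simp
    define h :: "'b \<Rightarrow> 'a \<times> nat" where "h c = (if c \<in> D then (e c, 0) else (e (nx c), 1))" for c
    have hinj: "inj_on h C"
    proof (rule inj_onI)
      fix c c' assume c: "c \<in> C" "c' \<in> C" "h c = h c'"
      have F: "c \<in> Field r" "c' \<in> Field r" using c CF by auto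
      show "c = c'"
      proof (cases "c \<in> D")
        case True
        then have "c' \<in> D" "e c = e c'" using c(3) by (auto simp: h_def split: if_splits)
        then show ?thesis using einj True by (auto simp: inj_on_def)
      next
        case False
        then have cD': "c' \<notin> D" and "e (nx c) = e (nx c')"
          using c(3) by (auto simp: h_def split: if_splits)
        then have "nx c = nx c'" using einj nx(1) F by (auto simp: inj_on_def)
        then show ?thesis
          using nx_less[of c c'] nx_less[of c' c] c False cD' w(4)[OF F] by metis
      qed
    qed
    define r' where "r' = {(h x, h y) |x y. x \<in> C \<and> y \<in> C \<and> (x, y) \<in> r}"
    have wo': "Well_order r'" and F': "Field r' = h ` C"
      and iff: "\<And>x y. x \<in> C \<Longrightarrow> y \<in> C \<Longrightarrow> (h x, h y) \<in> r' \<longleftrightarrow> (x, y) \<in> r"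
      using Well_order_transport[OF wo CF hinj] unfolding r'_def by blast+
    have "C \<noteq> {}" using ne Dcof DC by blast
    moreover have "aboveS r' (h c) \<noteq> {}" if cC: "c \<in> C" for c
    proof -
      obtain d where d: "d \<in> D" "d \<in> aboveS r c" using DcofS cC CF by blast
      then have "d \<in> C" "d \<noteq> c" "(c, d) \<in> r" using DC by (auto simp: aboveS_def)
      then have "h d \<in> aboveS r' (h c)"
        using iff cC hinj by (auto simp: aboveS_def inj_on_def)
      then show ?thesis by blast
    qed
    ultimately have nc': "\<not> compact_space (wo_topology r')"
      unfolding noncompact_wo_topology_iff[OF wo'] F' by auto
    define k where "k = inv_into C h"
    have kh: "k (h c) = c" if "c \<in> C" for c
      unfolding k_def using hinj that by (rule inv_into_f_f)
    have kim: "k ` Field r' = C" unfolding F' image_image using kh by auto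
    have cont': "continuous_map (Alexandroff_compactification (wo_topology r'))
        (Alexandroff_compactification ?X) (map_option k)"
    proof (rule continuous_map_wo_compactification[OF wo nc wo' nc'])
      show "k ` Field r' \<subseteq> Field r" "closedin ?X (k ` Field r')"
        using kim CF clC by auto
      show "cofinal_in r (k ` Field r')"
        unfolding kim cofinal_in_def using CF DC Dcof by blast
      show "(x, y) \<in> r' \<longleftrightarrow> (k x, k y) \<in> r" if "x \<in> Field r'" "y \<in> Field r'" for x y
        using that iff kh unfolding F' by auto
    qed
    have "continuous_map (Alexandroff_compactification (wo_topology r')) X (f \<circ> map_option k)"
      using cont' cont by (rule continuous_map_compose)
    moreover have "(f \<circ> map_option k) ` Some ` Field r' \<subseteq> A"
    proof -
      have "f (Some c) \<in> A" if "c \<in> C" for c using that CF fA by blast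
      then show ?thesis using kim by auto
    qed
    ultimately have "escaping_map r' X A (f \<circ> map_option k)"
      unfolding escaping_map_def using wo' nc' fN by auto
    then show ?thesis by blast
  qed
qed

theorem weakly_HausdorffD:
  fixes X :: "'a topology" and K :: "'k topology"
  assumes X: "weakly_Hausdorff X"
    and K: "compact_space K" "Hausdorff_space K" and f: "continuous_map K X f"
  shows "closedin X (f ` topspace K)"
proof -
  define D where "D = inv_into (topspace K) f ` f ` topspace K"
  have DK: "D \<subseteq> topspace K" unfolding D_def by (auto intro: inv_into_into)
  have fD: "f ` D = f ` topspace K"
    unfolding D_def by (auto simp: image_image f_inv_into_f)
  have injD: "inj_on f D"
    unfolding D_def by (auto simp: inj_on_def f_inv_into_f)
  define C where "C = K closure_of D"
  have CK: "C \<subseteq> topspace K" unfolding C_def by (rule closure_of_subset_topspace)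
  have DC: "D \<subseteq> C" unfolding C_def using DK by (rule closure_of_subset)
  have fC: "f ` C = f ` topspace K" using CK DC fD by blast
  define e where "e x = {f ` (D \<inter> U) |U. openin K U \<and> x \<in> U}" for x
  have inj: "inj_on e C"
  proof (rule inj_onI, rule ccontr)
    fix x y assume xy: "x \<in> C" "y \<in> C" "e x = e y" "x \<noteq> y"
    then obtain U V where UV: "openin K U" "openin K V" "x \<in> U" "y \<in> V" "disjnt U V"
      using K(2) CK unfolding Hausdorff_space_def by (meson subsetD)
    have "f ` (D \<inter> U) \<in> e y" using UV xy(3) unfolding e_def by blast
    then obtain V' where V': "openin K V'" "y \<in> V'" "f ` (D \<inter> U) = f ` (D \<inter> V')"
      unfolding e_def by blast
    have "D \<inter> U = D \<inter> V'"
      using V'(3) inj_on_image_eq_iff[OF injD, of "D \<inter> U" "D \<inter> V'"] by blast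
    moreover have "openin K (V \<inter> V')" "y \<in> V \<inter> V'" using UV V' by auto
    then obtain d where "d \<in> D" "d \<in> V \<inter> V'"
      using xy(2) unfolding C_def in_closure_of by blast
    ultimately show False using UV(5) by (auto simp: disjnt_def)
  qed
  define k where "k = inv_into C e"
  have ke: "k (e c) = c" if "c \<in> C" for c
    unfolding k_def using inj that by (rule inv_into_f_f)
  define K' where "K' = pullback_topology (e ` C) k K"
  have top: "topspace K' = e ` C"
    unfolding K'_def topspace_pullback_topology using ke CK by auto
  have op: "openin K' S \<longleftrightarrow> (\<exists>U. openin K U \<and> S = k -` U \<inter> e ` C)" for S
    unfolding K'_def by (rule openin_pullback_topology)
  have "homeomorphic_maps (subtopology K C) K' e k"
    unfolding homeomorphic_maps_def
  proof (intro conjI)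
    have topC: "topspace (subtopology K C) = C" using CK by auto
    show "\<forall>x\<in>topspace (subtopology K C). k (e x) = x" "\<forall>y\<in>topspace K'. e (k y) = y"
      using ke by (auto simp: top)
    show "continuous_map (subtopology K C) K' e"
      unfolding continuous_map_def topC top
    proof (intro conjI allI impI)
      fix S assume "openin K' S"
      then obtain U where "openin K U" "S = k -` U \<inter> e ` C" unfolding op by blast
      then have "openin K U" "{x \<in> C. e x \<in> S} = U \<inter> C" using ke by auto
      then show "openin (subtopology K C) {x \<in> C. e x \<in> S}"
        by (auto simp: openin_subtopology)
    qed auto
    show "continuous_map K' (subtopology K C) k"
      unfolding continuous_map_def topC top
    proof (intro conjI allI impI)
      show "k \<in> e ` C \<rightarrow> C" using ke by auto
      fix S assume "openin (subtopology K C) S"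
      then obtain U where "openin K U" "S = U \<inter> C" by (auto simp: openin_subtopology)
      then have "openin K U" "{x \<in> e ` C. k x \<in> S} = k -` U \<inter> e ` C" using ke by auto
      then show "openin K' {x \<in> e ` C. k x \<in> S}" unfolding op by blast
    qed
  qed
  then have homeo: "subtopology K C homeomorphic_space K'" and kc: "continuous_map K' (subtopology K C) k"
    by (auto simp: homeomorphic_space_def homeomorphic_maps_def)
  have "compact_space (subtopology K C)"
    using K(1) by (intro compact_space_subtopology closedin_compact_space) (auto simp: C_def)
  moreover have "Hausdorff_space (subtopology K C)"
    using K(2) by (rule Hausdorff_space_subtopology)
  ultimately have "compact_space K'" "Hausdorff_space K'"
    using homeomorphic_compact_space[OF homeo] homeomorphic_Hausdorff_space[OF homeo] by auto
  moreover have "continuous_map K' X (f \<circ> k)"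
    using continuous_map_compose[OF continuous_map_into_fulltopology[OF kc] f] .
  ultimately have "closedin X ((f \<circ> k) ` topspace K')"
    using X unfolding weakly_Hausdorff_def by blast
  moreover have "(f \<circ> k) ` topspace K' = f ` topspace K"
    unfolding top fC[symmetric] using ke by (force simp: image_iff)
  ultimately show ?thesis by simp
qed

end

theory Submission
  imports Defs
begin

text \<open>
  Let \<open>f : \<alpha> \<rightarrow> X\<close> be a map. Images under \<open>f\<close> of initial segments \<open>[0, b]\<close> are closed, because
  \<open>X\<close> is weakly Hausdorff. If all tails \<open>f [a, \<infinity>)\<close> are closed, then by compactness they have a
  common point \<open>x\<close>, and \<open>f\<close> is constant on the closed cofinal set \<open>f\<^sup>-\<^sup>1 {x}\<close>. Otherwise some tail
  \<open>A = f [a, \<infinity>)\<close> is not closed, and there is a map \<open>g : \<gamma> \<union> {\<infinity>} \<rightarrow> X\<close> with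
  \<open>g \<gamma> \<subseteq> A\<close> and \<open>g \<infinity> \<notin> A\<close>. Each \<open>f [a, b]\<close> is closed and misses \<open>g \<infinity>\<close>, so \<open>g\<close> eventually
  leaves it; hence the preimage under \<open>f\<close> of \<open>g [0, \<infinity>]\<close> is cofinal. Let \<open>c \<in> \<gamma> \<union> {\<infinity>}\<close> be
  minimal such that \<open>\<beta> = f\<^sup>-\<^sup>1 (g [0, c])\<close> is cofinal. Every neighbourhood of \<open>g c\<close> contains
  some \<open>g (d, c]\<close>, and \<open>f\<^sup>-\<^sup>1 (g [0, d])\<close> is bounded by minimality, so \<open>f\<close> restricted to the
  closed cofinal set \<open>\<beta>\<close> converges to \<open>g c\<close>.
\<close>

section \<open>Separation and closed images\<close>

lemma openin_under:
  assumes "Well_order r"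
  shows "openin (wo_topology r) (under r x)"
proof -
  have "under r y \<subseteq> under r x" if "y \<in> under r x" for y
    using that Well_order_trans[OF assms] by (auto simp: under_def)
  then show ?thesis
    unfolding openin_wo_topology[OF assms] using under_Field[of r x] by blast
qed

lemma Hausdorff_space_wo_topology:
  assumes wo: "Well_order r"
  shows "Hausdorff_space (wo_topology r)"
proof -
  have separated: "\<exists>U V. openin (wo_topology r) U \<and> openin (wo_topology r) V \<and>
      x \<in> U \<and> y \<in> V \<and> disjnt U V"
    if "x \<in> Field r" "y \<in> Field r" "x \<noteq> y" "(x, y) \<in> r" for x y
  proof (intro exI conjI)
    show "openin (wo_topology r) (under r x)" "openin (wo_topology r) (aboveS r x)"
      using openin_under[OF wo] openin_underS_aboveS that(1) by auto
    show "x \<in> under r x" "y \<in> aboveS r x"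
      using that Well_order_refl[OF wo] by (auto simp: under_def aboveS_def)
    show "disjnt (under r x) (aboveS r x)"
      using Well_order_antisym[OF wo] by (auto simp: disjnt_def under_def aboveS_def)
  qed
  show ?thesis
    unfolding Hausdorff_space_def topspace_wo_topology
    using separated Well_order_total[OF wo] by (metis disjnt_sym)
qed

text \<open>Closed initial segments are both open and compact, so the Hausdorff space is locally
  compact, as its one-point compactification requires.\<close>

lemma Hausdorff_space_wo_compactification:
  assumes wo: "Well_order r"
  shows "Hausdorff_space (Alexandroff_compactification (wo_topology r))"
proof -
  have "locally_compact_space (wo_topology r)"
    unfolding locally_compact_space_def
  proof
    fix x assume "x \<in> topspace (wo_topology r)"
    then have "x \<in> under r x"
      using Well_order_refl[OF wo] by (simp add: under_def)
    then show "\<exists>U K. openin (wo_topology r) U \<and> compactin (wo_topology r) K \<and> x \<in> U \<and> U \<subseteq> K"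
      using openin_under[OF wo] compactin_under[OF wo] by blast
  qed
  then show ?thesis
    using Hausdorff_space_wo_topology[OF wo] by (simp add: Hausdorff_space_Alexandroff_compactification)
qed

lemma weakly_Hausdorff_closedin_image:
  assumes "weakly_Hausdorff X" "Hausdorff_space Y" "compactin Y C" "continuous_map Y X f"
  shows "closedin X (f ` C)"
proof -
  have "C \<subseteq> topspace Y"
    using assms(3) by (rule compactin_subset_topspace)
  then have "topspace (subtopology Y C) = C"
    by auto
  then show ?thesis
    using weakly_HausdorffD[OF assms(1), of "subtopology Y C" f] assms
    by (simp add: compact_space_subtopology Hausdorff_space_subtopology continuous_map_from_subtopology)
qed

lemma weakly_Hausdorff_closedin_singleton:
  assumes "weakly_Hausdorff X" "x \<in> topspace X"
  shows "closedin X {x}"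
  using weakly_Hausdorff_closedin_image[OF assms(1), of "discrete_topology {x}" "{x}" id] assms(2)
  by (simp add: Hausdorff_space_discrete_topology)

section \<open>Convergence along closed cofinal sets\<close>

text \<open>Assumption \<open>near\<close> says that on the preimage of \<open>L\<close> the points
  sent outside a neighbourhood of \<open>q\<close> are bounded. Thus \<open>f\<close> converges to
  \<open>q\<close> there, and \<open>q\<close> is the value to assign at infinity.\<close>

lemma continuous_extension_on_preimage:
  fixes X :: "'a topology" and r :: "'b rel"
  assumes wo: "Well_order r" and nc: "\<not> compact_space (wo_topology r)"
    and f: "continuous_map (wo_topology r) X f"
    and L: "closedin X L" and q: "q \<in> topspace X"
    and cof: "cofinal_in r {x \<in> Field r. f x \<in> L}"
    and near: "\<And>U. openin X U \<Longrightarrow> q \<in> U \<Longrightarrow> \<not> cofinal_in r {x \<in> Field r. f x \<in> L - U}"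
  shows "\<exists>B. closedin (wo_topology r) B \<and> cofinal_in r B \<and>
           (\<exists>g. continuous_map
                  (subtopology (Alexandroff_compactification (wo_topology r))
                     (insert None (Some ` B))) X g \<and>
                (\<forall>b\<in>B. g (Some b) = f b))"
proof -
  define B where "B = {x \<in> Field r. f x \<in> L}"
  define g where "g z = (case z of None \<Rightarrow> q | Some x \<Rightarrow> f x)" for z
  let ?A = "Alexandroff_compactification (wo_topology r)"
  let ?S = "insert None (Some ` B)"
  have fX: "f x \<in> topspace X" if "x \<in> Field r" for x
    using f that by (auto simp: continuous_map_def)
  have BF: "B \<subseteq> Field r" by (auto simp: B_def)
  have top: "topspace (subtopology ?A ?S) = ?S"
    using BF by auto
  have "closedin (wo_topology r) B"
    using closedin_continuous_map_preimage[OF f L] by (simp add: B_def)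
  moreover have "continuous_map (subtopology ?A ?S) X g"
    unfolding continuous_map_def top
  proof (intro conjI allI impI)
    show "g \<in> ?S \<rightarrow> topspace X"
      using q fX BF by (auto simp: g_def)
    fix U assume U: "openin X U"
    define P where "P = {x \<in> Field r. f x \<in> U}"
    have P: "openin (wo_topology r) P"
      using openin_continuous_map_preimage[OF f U] by (simp add: P_def)
    show "openin (subtopology ?A ?S) {z \<in> ?S. g z \<in> U}"
    proof (cases "q \<in> U")
      case False
      have "openin ?A (Some ` P)"
        using P by (simp add: openin_Alexandroff_compactification_image_Some)
      moreover have "{z \<in> ?S. g z \<in> U} = Some ` P \<inter> ?S"
        using False BF by (auto simp: g_def P_def)
      ultimately show ?thesis
        unfolding openin_subtopology by blast
    next
      case True
      then obtain a where a: "a \<in> Field r" "\<And>b. b \<in> B \<Longrightarrow> f b \<notin> U \<Longrightarrow> (a, b) \<notin> r"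
        using near[OF U] unfolding cofinal_in_def B_def by blast
      \<comment> \<open>The whole ray above \<open>a\<close> is added: it may contain points sent
        outside \<open>U\<close>, but none of them lies in \<open>B\<close>.\<close>
      define V where "V = insert None (Some ` (P \<union> aboveS r a))"
      have "Some -` V = P \<union> aboveS r a"
        by (auto simp: V_def)
      moreover have "openin (wo_topology r) (P \<union> aboveS r a)"
        using P openin_underS_aboveS(2)[OF a(1)] by blast
      ultimately have "openin ?A V"
        unfolding openin_wo_compactification[OF wo nc] using a(1) by (auto simp: V_def)
      moreover have "{z \<in> ?S. g z \<in> U} = V \<inter> ?S"
        using True BF a(2) by (fastforce simp: g_def P_def V_def aboveS_def)
      ultimately show ?thesis
        unfolding openin_subtopology by blast
    qed
  qed
  ultimately show ?thesis
    using cof by (intro exI[of _ B] conjI exI[of _ g]) (auto simp: B_def g_def)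
qed

section \<open>Cofinal preimages\<close>

text \<open>The minimal \<open>c\<close> is either the least point of \<open>s\<close> with
  \<open>N c\<close> cofinal or, if there is none, the point at infinity. In both cases
  \<open>q\<close> is the value of \<open>g\<close> at \<open>c\<close>, and \<open>N d\<close> is
  not cofinal for any earlier \<open>d\<close>.\<close>

lemma cofinal_preimage_least_initial_segment:
  fixes s :: "'c rel"
  assumes wos: "Well_order s" and ncs: "\<not> compact_space (wo_topology s)"
    and ne: "Field r \<noteq> {}" and wH: "weakly_Hausdorff X"
    and g: "continuous_map (Alexandroff_compactification (wo_topology s)) X g"
    and cof: "cofinal_in r {x \<in> Field r. f x \<in> g ` insert None (Some ` Field s)}"
  shows "\<exists>L q. closedin X L \<and> q \<in> topspace X \<and> cofinal_in r {x \<in> Field r. f x \<in> L} \<and>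
    (\<forall>U. openin X U \<and> q \<in> U \<longrightarrow> \<not> cofinal_in r {x \<in> Field r. f x \<in> L - U})"
proof -
  let ?A = "Alexandroff_compactification (wo_topology s)"
  define N where "N c = {x \<in> Field r. f x \<in> g ` Some ` under s c}" for c
  have gX: "g z \<in> topspace X" if "z \<in> insert None (Some ` Field s)" for z
    using g that by (auto simp: continuous_map_def)
  have gSome: "continuous_map (wo_topology s) X (\<lambda>x. g (Some x))"
    using continuous_map_compose[OF continuous_map_Some g] by (simp add: o_def)
  have mono: "\<not> cofinal_in r S" if "\<not> cofinal_in r T" "S \<subseteq> T" "T \<subseteq> Field r" for S T
    using that unfolding cofinal_in_def by blast
  show ?thesis
  proof (cases "\<exists>c\<in>Field s. cofinal_in r (N c)")
    case True
    then obtain c where c: "c \<in> Field s" "cofinal_in r (N c)"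
      and least: "\<And>d. d \<in> Field s \<Longrightarrow> cofinal_in r (N d) \<Longrightarrow> (c, d) \<in> s"
      using Well_order_least[OF wos, of "{c \<in> Field s. cofinal_in r (N c)}"] by blast
    let ?L = "g ` Some ` under s c"
    have "closedin X ?L"
      using weakly_Hausdorff_closedin_image[OF wH Hausdorff_space_wo_topology[OF wos]
          compactin_under[OF wos] gSome] by (simp add: image_image)
    moreover have "\<not> cofinal_in r {x \<in> Field r. f x \<in> ?L - U}"
      if U: "openin X U" "g (Some c) \<in> U" for U
    proof -
      let ?V = "{x \<in> Field s. g (Some x) \<in> U}"
      have "openin (wo_topology s) ?V"
        using openin_continuous_map_preimage[OF gSome U(1)] by simp
      then consider "under s c \<subseteq> ?V"
        | d where "d \<in> underS s c" "under s c \<inter> aboveS s d \<subseteq> ?V"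
        using c(1) U(2) unfolding openin_wo_topology[OF wos] by blast
      then show ?thesis
      proof cases
        \<comment> \<open>All of \<open>?L\<close> lies in \<open>U\<close>, and the empty set is
          not cofinal in a nonempty order.\<close>
        case 1
        then have "{x \<in> Field r. f x \<in> ?L - U} = {}" by auto
        then show ?thesis using ne unfolding cofinal_in_def by auto
      next
        \<comment> \<open>Values in \<open>?L\<close> outside \<open>U\<close> are taken only at
          indices up to \<open>d\<close>, so their preimage lies in \<open>N d\<close>.\<close>
        case 2
        have dF: "d \<in> Field s" using 2(1) by (auto simp: underS_def Field_def)
        have "\<not> cofinal_in r (N d)"
          using least[OF dF] 2(1) Well_order_antisym[OF wos] by (auto simp: underS_def)
        moreover have "y \<in> under s d" if "y \<in> under s c" "g (Some y) \<notin> U" for y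
        proof -
          have "y \<in> Field s" using that(1) under_Field[of s c] by blast
          then show ?thesis
            using that 2(2) aboveS_iff[OF wos dF] by (auto simp: under_def)
        qed
        then have "{x \<in> Field r. f x \<in> ?L - U} \<subseteq> N d" by (auto simp: N_def)
        ultimately show ?thesis by (rule mono) (auto simp: N_def)
      qed
    qed
    ultimately show ?thesis
      using c gX unfolding N_def by blast
  next
    case False
    let ?L = "g ` insert None (Some ` Field s)"
    have "closedin X ?L"
      using weakly_HausdorffD[OF wH _ Hausdorff_space_wo_compactification[OF wos] g]
      by (simp add: compact_space_Alexandroff_compactification)
    moreover have "\<not> cofinal_in r {x \<in> Field r. f x \<in> ?L - U}"
      if U: "openin X U" "g None \<in> U" for U
    proof -
      have "openin ?A {z \<in> topspace ?A. g z \<in> U}"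
        using openin_continuous_map_preimage[OF g U(1)] .
      then obtain d where d: "d \<in> Field s" "Some ` aboveS s d \<subseteq> {z \<in> topspace ?A. g z \<in> U}"
        using U(2) unfolding openin_wo_compactification[OF wos ncs] by auto
      have "y \<in> under s d" if "y \<in> Field s" "g (Some y) \<notin> U" for y
        using that d aboveS_iff[OF wos d(1)] by (auto simp: under_def)
      then have "{x \<in> Field r. f x \<in> ?L - U} \<subseteq> N d" using U(2) by (auto simp: N_def)
      moreover have "\<not> cofinal_in r (N d)" using False d(1) by blast
      ultimately show ?thesis using mono[of "N d"] by (auto simp: N_def)
    qed
    ultimately show ?thesis
      using cof gX by blast
  qed
qed

lemma cofinal_preimage_escaping_map:
  fixes r :: "'b rel" and s :: "'c rel"
  assumes wo: "Well_order r" and f: "continuous_map (wo_topology r) X f"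
    and wH: "weakly_Hausdorff X" and a: "a \<in> Field r"
    and esc: "escaping_map s X (f ` above r a) g"
  shows "cofinal_in r {x \<in> Field r. f x \<in> g ` insert None (Some ` Field s)}"
  unfolding cofinal_in_def
proof (intro conjI ballI)
  let ?A = "Alexandroff_compactification (wo_topology s)"
  have wos: "Well_order s" and ncs: "\<not> compact_space (wo_topology s)"
    and g: "continuous_map ?A X g"
    and gA: "\<And>y. y \<in> Field s \<Longrightarrow> g (Some y) \<in> f ` above r a" and gN: "g None \<notin> f ` above r a"
    using esc by (auto simp: escaping_map_def)
  fix b assume b: "b \<in> Field r"
  \<comment> \<open>The closed interval from \<open>a\<close> to \<open>b\<close>, empty if
    \<open>b\<close> precedes \<open>a\<close>.\<close>
  let ?C = "under r b \<inter> above r a"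
  have "x \<in> above r a \<longleftrightarrow> x \<in> Field r - underS r a" for x
    using Well_order_total[OF wo a, of x] Well_order_antisym[OF wo, of x a] Well_order_refl[OF wo a]
      FieldI2[of a x r] by (auto simp: above_def underS_def)
  then have "above r a = Field r - underS r a" by blast
  then have "closedin (wo_topology r) (above r a)"
    using openin_underS_aboveS(1)[OF a] by (metis closedin_diff closedin_topspace topspace_wo_topology)
  then have "compactin (wo_topology r) ?C"
    using compact_Int_closedin[OF compactin_under[OF wo]] by blast
  then have cl: "closedin X (f ` ?C)"
    using weakly_Hausdorff_closedin_image[OF wH Hausdorff_space_wo_topology[OF wo] _ f] by blast
  have "g None \<in> topspace X - f ` ?C"
    using g gN by (auto simp: continuous_map_def)
  moreover have "openin ?A {z \<in> topspace ?A. g z \<in> topspace X - f ` ?C}"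
    using cl by (intro openin_continuous_map_preimage[OF g]) blast
  ultimately obtain d where d: "d \<in> Field s"
    "Some ` aboveS s d \<subseteq> {z \<in> topspace ?A. g z \<in> topspace X - f ` ?C}"
    unfolding openin_wo_compactification[OF wos ncs] by auto
  \<comment> \<open>A noncompact well-ordered space has no last point, so something lies beyond
    \<open>d\<close>.\<close>
  obtain y where "y \<in> aboveS s d"
    using ncs d(1) unfolding noncompact_wo_topology_iff[OF wos] by blast
  then have y: "y \<in> Field s" "g (Some y) \<notin> f ` ?C"
    using d(2) by (auto simp: aboveS_def Field_def)
  \<comment> \<open>This value of \<open>g\<close> lies in the image of the tail from
    \<open>a\<close> but not in that of \<open>?C\<close>, so \<open>x\<close> must lie beyond
    \<open>b\<close>.\<close>
  obtain x where x: "x \<in> above r a" "g (Some y) = f x"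
    using gA[OF y(1)] by blast
  have xF: "x \<in> Field r" using x(1) by (auto simp: above_def Field_def)
  have "(x, b) \<notin> r" using x y(2) by (auto simp: under_def)
  then have "(b, x) \<in> r" using Well_order_total[OF wo b xF] by blast
  moreover have "f x \<in> g ` insert None (Some ` Field s)"
    unfolding x(2)[symmetric] using y(1) by blast
  ultimately show "\<exists>x\<in>{x \<in> Field r. f x \<in> g ` insert None (Some ` Field s)}. (b, x) \<in> r"
    using xF by blast
qed blast

text \<open>Tails are nested, so their closed images have the finite intersection property, and
  compactness gives a common point. A point in every tail image has a cofinal fiber, stated here as
  the preimage of a singleton so that the singleton can serve as \<open>L\<close>.\<close>

lemma closed_tails_cofinal_fiber:
  assumes wo: "Well_order r" and ne: "Field r \<noteq> {}" and X: "compact_space X"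
    and closed: "\<And>a. a \<in> Field r \<Longrightarrow> closedin X (f ` above r a)"
  shows "\<exists>x\<in>topspace X. cofinal_in r {y \<in> Field r. f y \<in> {x}}"
proof -
  let ?T = "\<lambda>a. f ` above r a"
  have bound: "\<exists>b\<in>Field r. \<forall>a\<in>F. (a, b) \<in> r" if "finite F" "F \<subseteq> Field r" for F
    using that
  proof (induction F rule: finite_induct)
    case empty
    then show ?case using ne by blast
  next
    case (insert c F)
    then obtain b where "b \<in> Field r" "\<forall>a\<in>F. (a, b) \<in> r" by blast
    then show ?case
      using Well_order_total[OF wo, of b c] Well_order_refl[OF wo] Well_order_trans[OF wo] insert.prems
      by (metis insert_iff insert_subset)
  qed
  have fip: "\<Inter>(?T ` F) \<noteq> {}" if F: "finite F" "F \<subseteq> Field r" for F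
  proof -
    obtain b where "b \<in> Field r" "\<forall>a\<in>F. (a, b) \<in> r"
      using bound[OF F] by blast
    then have "f b \<in> \<Inter>(?T ` F)" by (auto simp: above_def)
    then show ?thesis by blast
  qed
  have "\<Inter>(?T ` Field r) \<noteq> {}"
    using X closed fip unfolding compact_space_fip
    by (smt (verit) finite_subset_image imageE)
  then obtain x where x: "\<And>a. a \<in> Field r \<Longrightarrow> x \<in> ?T a" by blast
  have "x \<in> topspace X"
    using ne x closed closedin_subset by blast
  moreover have "cofinal_in r {y \<in> Field r. f y \<in> {x}}"
    unfolding cofinal_in_def
  proof (intro conjI ballI)
    fix a assume "a \<in> Field r"
    then obtain y where "(a, y) \<in> r" "x = f y" using x by (auto simp: above_def)
    then show "\<exists>b\<in>{y \<in> Field r. f y \<in> {x}}. (a, b) \<in> r" by (auto simp: Field_def)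
  qed blast
  ultimately show ?thesis by blast
qed

theorem corollary7p11:
  fixes X :: "'a topology"
  assumes "strongly_pseudoradial X"
    and "weakly_Hausdorff X"
    and "compact_space X"
  shows "strongly_pseudoradially_compact TYPE('b) X"
  unfolding strongly_pseudoradially_compact_def
proof (intro allI impI)
  fix r :: "'b rel" and f :: "'b \<Rightarrow> 'a"
  assume "Well_order r \<and> \<not> compact_space (wo_topology r) \<and> continuous_map (wo_topology r) X f"
  then have wo: "Well_order r" and nc: "\<not> compact_space (wo_topology r)"
    and f: "continuous_map (wo_topology r) X f" by auto
  have ne: "Field r \<noteq> {}"
    using nc noncompact_wo_topology_iff[OF wo] by blast
  \<comment> \<open>Both cases produce the data needed by
    \<open>continuous_extension_on_preimage\<close>.\<close>
  have "\<exists>L q. closedin X L \<and> q \<in> topspace X \<and> cofinal_in r {x \<in> Field r. f x \<in> L} \<and>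
    (\<forall>U. openin X U \<and> q \<in> U \<longrightarrow> \<not> cofinal_in r {x \<in> Field r. f x \<in> L - U})"
  proof (cases "\<forall>a\<in>Field r. closedin X (f ` above r a)")
    case True
    then obtain x where x: "x \<in> topspace X" "cofinal_in r {y \<in> Field r. f y \<in> {x}}"
      using closed_tails_cofinal_fiber[OF wo ne assms(3), of f] by blast
    \<comment> \<open>With \<open>q = x\<close>, no point of the singleton is outside a
      neighbourhood of \<open>q\<close>.\<close>
    moreover have "\<not> cofinal_in r {y \<in> Field r. f y \<in> {x} - U}" if "x \<in> U" for U
      using that ne by (auto simp: cofinal_in_def)
    ultimately show ?thesis
      using weakly_Hausdorff_closedin_singleton[OF assms(2)] by blast
  next
    case False
    then obtain a where a: "a \<in> Field r" "\<not> closedin X (f ` above r a)" by blast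
    have "f ` above r a \<subseteq> topspace X"
      using f by (auto simp: continuous_map_def above_def Field_def)
    then obtain s :: "('a \<times> nat) rel" and g where esc: "escaping_map s X (f ` above r a) g"
      using assms(1) a(2) unfolding strongly_pseudoradial_def by blast
    have s: "Well_order s" "\<not> compact_space (wo_topology s)"
      "continuous_map (Alexandroff_compactification (wo_topology s)) X g"
      using esc by (auto simp: escaping_map_def)
    show ?thesis
      by (rule cofinal_preimage_least_initial_segment[OF s(1,2) ne assms(2) s(3)
          cofinal_preimage_escaping_map[OF wo f assms(2) a(1) esc]])
  qed
  then obtain L q where L: "closedin X L" "q \<in> topspace X" "cofinal_in r {x \<in> Field r. f x \<in> L}"
    and near: "\<And>U. openin X U \<Longrightarrow> q \<in> U \<Longrightarrow> \<not> cofinal_in r {x \<in> Field r. f x \<in> L - U}"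
    by blast
  show "\<exists>B. closedin (wo_topology r) B \<and> cofinal_in r B \<and>
           (\<exists>g. continuous_map
                  (subtopology (Alexandroff_compactification (wo_topology r))
                     (insert None (Some ` B))) X g \<and>
                (\<forall>b\<in>B. g (Some b) = f b))"
    by (rule continuous_extension_on_preimage[OF wo nc f L near])
qed

end
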